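(* Let $(X,d)$ and $(Y,\varrho)$ be metric spaces. Consider $c> 0$ and $r > 0$, a point $\bar{x} \in X$, and a mapping $g: X \to Y$ defined on the whole $X$. Assume that there is a $\lambda \in (0,1)$ such that for each $u \in B_X(\bar{x},r)$ and each $y \in B_Y(g(\bar{x}),cr)$, with $0 < \varrho(g(u),y) < cr$, there is a point $u'\in X$ satisfying $$\varrho(g(u'),y) + c\,d(u,u') \leq \lambda\, \varrho(g(u),y).$$ Then $g$ has property $(\mathcal{O})$ on $B_X(\bar{x},r) \times B_Y(g(\bar{x}),cr)$ for $c$ and $\gamma(x):= r - d(x, \bar{x})$, $x \in B_X(\bar{x},r)$. In particular, $g$ is almost regular around $\bar{x}$ with the constant $c$.
   Context: $B_X(x,r)$, $B_Y(y,r)$ denote open balls and $\overline{C}$ the closure of $C$. For non-empty $U\subset X$, $V\subset Y$ and $\gamma$ defined on $U$, a single-valued mapping $g:X\to Y$ has property $(\mathcal{O})$ on $U\times V$ for $c$ and $\gamma$ provided that $B_Y(g(x),ct)\cap V\subset\overline{g(B_X(x,t))}$ for each $x\in U$ and each $t\in(0,\gamma(x))$. The mapping $g$ is almost regular around $\bar x$ with the constant $c$ means that it is almost open with the constant $c$ around $\bar x$: there is a $\delta>0$ such that $B_Y(g(x),ct)\cap B_Y(g(\bar x),\delta)\subset\overline{g(B_X(x,t))}$ for each $x\in B_X(\bar x,\delta)$ and each $t\in(0,\delta)$. *)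

theory Defs
  imports "HOL-Analysis.Analysis"
begin

text \<open>
  Only the values of \<open>\<gamma>\<close> on \<open>U\<close> matter. Nonemptiness of \<open>U\<close> and \<open>V\<close>, a standing
  requirement of the notion, is made part of the property.
\<close>

definition property_O_on ::
  "('a::metric_space \<Rightarrow> 'b::metric_space) \<Rightarrow> 'a set \<Rightarrow> 'b set \<Rightarrow> real \<Rightarrow> ('a \<Rightarrow> real) \<Rightarrow> bool"
where
  "property_O_on g U V c \<gamma> \<longleftrightarrow>
     U \<noteq> {} \<and> V \<noteq> {} \<and>
     (\<forall>x\<in>U. \<forall>t\<in>{0<..<\<gamma> x}. ball (g x) (c * t) \<inter> V \<subseteq> closure (g ` ball x t))"

definition almost_open_around ::
  "('a::metric_space \<Rightarrow> 'b::metric_space) \<Rightarrow> 'a \<Rightarrow> real \<Rightarrow> bool"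
where
  "almost_open_around g xbar c \<longleftrightarrow>
     (\<exists>\<delta>>0. \<forall>x\<in>ball xbar \<delta>. \<forall>t\<in>{0<..<\<delta>}.
        ball (g x) (c * t) \<inter> ball (g xbar) \<delta> \<subseteq> closure (g ` ball x t))"

definition almost_regular_around ::
  "('a::metric_space \<Rightarrow> 'b::metric_space) \<Rightarrow> 'a \<Rightarrow> real \<Rightarrow> bool"
where
  "almost_regular_around g xbar c \<longleftrightarrow> almost_open_around g xbar c"

end

theory Submission
  imports Defs
begin

text \<open>
  Iterate the descent step from \<open>x\<close>. The bound \<open>dist (g u) y + c * dist x u \<le> dist (g x) y\<close>
  survives every step and, since \<open>dist (g x) y < c * t\<close>, keeps the iterates in \<open>ball x t\<close>, while
  \<open>dist (g u) y\<close> shrinks geometrically. Only closures are claimed, so the iterates need not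
  converge and no completeness is required.
\<close>

lemma descent_iterate:
  fixes g :: "'a::metric_space \<Rightarrow> 'b::metric_space"
  assumes "c > 0" "lam \<ge> 0" "lam \<le> 1" and yt: "dist (g x) y < c * t"
    and step: "\<And>u. u \<in> ball x t \<Longrightarrow> 0 < dist (g u) y \<Longrightarrow> dist (g u) y < c * t \<Longrightarrow>
           \<exists>u'. dist (g u') y + c * dist u u' \<le> lam * dist (g u) y"
  shows "\<exists>u\<in>ball x t. dist (g u) y \<le> lam ^ n * dist (g x) y"
proof -
  have "\<exists>u. dist (g u) y + c * dist x u \<le> dist (g x) y \<and> dist (g u) y \<le> lam ^ n * dist (g x) y"
  proof (induction n)
    case 0
    show ?case by (intro exI[of _ x]) simp
  next
    case (Suc n)
    then obtain u where u: "dist (g u) y + c * dist x u \<le> dist (g x) y"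
      and un: "dist (g u) y \<le> lam ^ n * dist (g x) y" by blast
    show ?case
    \<comment> \<open>The descent hypothesis offers no new point once \<open>g u\<close> equals
      \<open>y\<close>; then \<open>u\<close> itself serves for index \<open>Suc n\<close> as
      well.\<close>
    proof (cases "dist (g u) y = 0")
      case True
      with u \<open>lam \<ge> 0\<close> show ?thesis by (intro exI[of _ u]) simp
    next
      case False
      have "c * dist x u < c * t" using u yt zero_le_dist[of "g u" y] by linarith
      then have "u \<in> ball x t" using \<open>c > 0\<close> by simp
      moreover have "0 \<le> c * dist x u" using \<open>c > 0\<close> by simp
      then have "dist (g u) y < c * t" using u yt by linarith
      ultimately obtain u' where u': "dist (g u') y + c * dist u u' \<le> lam * dist (g u) y"
        using step False by fastforce
      \<comment> \<open>Dropping the factor \<open>lam\<close> bounds the cost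
        \<open>c * dist u u'\<close> of a move by the decrease of the distance to \<open>y\<close>,
        so the costs telescope along the iteration.\<close>
      have "lam * dist (g u) y \<le> dist (g u) y"
        using \<open>lam \<le> 1\<close> by (simp add: mult_left_le_one_le \<open>lam \<ge> 0\<close>)
      moreover have "c * dist x u' \<le> c * dist x u + c * dist u u'"
        using \<open>c > 0\<close> dist_triangle[of x u' u] by (simp flip: distrib_left)
      ultimately have "dist (g u') y + c * dist x u' \<le> dist (g x) y"
        using u u' by linarith
      moreover have "0 \<le> c * dist u u'" using \<open>c > 0\<close> by simp
      then have "dist (g u') y \<le> lam * dist (g u) y" using u' by linarith
      then have "dist (g u') y \<le> lam ^ Suc n * dist (g x) y"
        using mult_left_mono[OF un \<open>lam \<ge> 0\<close>] by (simp add: mult.assoc)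
      ultimately show ?thesis by blast
    qed
  qed
  then obtain u where u: "dist (g u) y + c * dist x u \<le> dist (g x) y"
    and un: "dist (g u) y \<le> lam ^ n * dist (g x) y" by blast
  have "c * dist x u < c * t" using u yt zero_le_dist[of "g u" y] by linarith
  then show ?thesis using un \<open>c > 0\<close> by auto
qed

text \<open>As \<open>lam ^ n\<close> tends to 0, the images of the iterates come arbitrarily close
  to \<open>y\<close>. Descent is assumed only inside \<open>ball x t\<close> and at distances below
  \<open>c * t\<close>, since the iterates never leave this region.\<close>

lemma descent_in_closure:
  fixes g :: "'a::metric_space \<Rightarrow> 'b::metric_space"
  assumes "c > 0" "0 \<le> lam" "lam < 1" "dist (g x) y < c * t"
    and "\<And>u. u \<in> ball x t \<Longrightarrow> 0 < dist (g u) y \<Longrightarrow> dist (g u) y < c * t \<Longrightarrow>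
           \<exists>u'. dist (g u') y + c * dist u u' \<le> lam * dist (g u) y"
  shows "y \<in> closure (g ` ball x t)"
  unfolding closure_approachable
proof (intro allI impI)
  fix e :: real assume "e > 0"
  have "(\<lambda>n. lam ^ n * dist (g x) y) \<longlonglongrightarrow> 0"
    using assms(2,3) by (intro tendsto_mult_left_zero LIMSEQ_realpow_zero)
  then have "\<forall>\<^sub>F n in sequentially. lam ^ n * dist (g x) y < e"
    using \<open>e > 0\<close> by (rule order_tendstoD)
  then obtain n where n: "lam ^ n * dist (g x) y < e"
    using eventually_happens'[OF sequentially_bot] by blast
  obtain u where "u \<in> ball x t" "dist (g u) y \<le> lam ^ n * dist (g x) y"
    using descent_iterate[of c lam g x y t n] assms by auto
  with n show "\<exists>z\<in>g ` ball x t. dist z y < e" by force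
qed

text \<open>The bound \<open>r - dist x xbar\<close> on the radius \<open>t\<close> stays away from
  0 near \<open>xbar\<close>, so a single \<delta> can replace it.\<close>

lemma property_O_on_imp_almost_open_around:
  fixes g :: "'a::metric_space \<Rightarrow> 'b::metric_space"
  assumes "r > 0" "s > 0"
    and "property_O_on g (ball xbar r) (ball (g xbar) s) c (\<lambda>x. r - dist x xbar)"
  shows "almost_open_around g xbar c"
  unfolding almost_open_around_def
proof (intro exI conjI ballI)
  \<comment> \<open>Half of \<open>r\<close> is spent on \<open>dist x xbar\<close> and half on
    \<open>t\<close>, whence \<open>t < r - dist x xbar\<close>; the bound \<open>s\<close> fits the
    ball around \<open>g xbar\<close> into the given one.\<close>
  let ?d = "min (r / 2) s"
  show "?d > 0" using assms by simp
  fix x t assume "x \<in> ball xbar ?d" and "t \<in> {0<..<?d}"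
  then have "x \<in> ball xbar r" "t \<in> {0<..<r - dist x xbar}"
    using \<open>r > 0\<close> by (auto simp: dist_commute)
  then have "ball (g x) (c * t) \<inter> ball (g xbar) s \<subseteq> closure (g ` ball x t)"
    using assms(3) unfolding property_O_on_def by blast
  moreover have "ball (g xbar) ?d \<subseteq> ball (g xbar) s" by (simp add: subset_ball)
  ultimately show "ball (g x) (c * t) \<inter> ball (g xbar) ?d \<subseteq> closure (g ` ball x t)" by blast
qed

theorem corollary4p3:
  fixes g :: "'a::metric_space \<Rightarrow> 'b::metric_space"
    and xbar :: 'a
    and c r :: real
  assumes "c > 0" and "r > 0"
    and "\<exists>lam\<in>{0<..<1::real}. \<forall>u\<in>ball xbar r. \<forall>y\<in>ball (g xbar) (c * r).
           0 < dist (g u) y \<and> dist (g u) y < c * r \<longrightarrow>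
           (\<exists>u'. dist (g u') y + c * dist u u' \<le> lam * dist (g u) y)"
  shows "property_O_on g (ball xbar r) (ball (g xbar) (c * r)) c (\<lambda>x. r - dist x xbar)
       \<and> almost_regular_around g xbar c"
proof -
  obtain lam where lam: "0 < lam" "lam < 1"
    and step: "\<And>u y. u \<in> ball xbar r \<Longrightarrow> y \<in> ball (g xbar) (c * r) \<Longrightarrow>
           0 < dist (g u) y \<Longrightarrow> dist (g u) y < c * r \<Longrightarrow>
           \<exists>u'. dist (g u') y + c * dist u u' \<le> lam * dist (g u) y"
    using assms(3) by force
  have "y \<in> closure (g ` ball x t)"
    if t: "t \<in> {0<..<r - dist x xbar}"
      and y: "y \<in> ball (g x) (c * t)" "y \<in> ball (g xbar) (c * r)" for x t y
  proof (rule descent_in_closure[OF \<open>c > 0\<close> less_imp_le[OF lam(1)] lam(2)])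
    show "dist (g x) y < c * t" using y by simp
    fix u assume u: "u \<in> ball x t" "0 < dist (g u) y" "dist (g u) y < c * t"
    \<comment> \<open>This is where the form of \<gamma> enters: \<open>dist xbar x + t < r\<close>
      keeps all of \<open>ball x t\<close> within the region where descent is available.\<close>
    have "u \<in> ball xbar r"
      using u(1) t dist_triangle[of xbar u x] by (simp add: dist_commute)
    moreover have "t \<le> r" using t zero_le_dist[of x xbar] by (simp, linarith)
    then have "dist (g u) y < c * r"
      using u(3) \<open>c > 0\<close> mult_left_mono[of t r c] by linarith
    ultimately show "\<exists>u'. dist (g u') y + c * dist u u' \<le> lam * dist (g u) y"
      using step y(2) u(2) by blast
  qed
  \<comment> \<open>The radii \<open>r\<close> and \<open>c * r\<close> are positive, which gives
    the nonemptiness of both balls.\<close>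
  then have "property_O_on g (ball xbar r) (ball (g xbar) (c * r)) c (\<lambda>x. r - dist x xbar)"
    unfolding property_O_on_def using assms(2) mult_pos_pos[OF assms(1,2)] by auto
  moreover from this have "almost_regular_around g xbar c"
    unfolding almost_regular_around_def
    using assms(1,2) by (intro property_O_on_imp_almost_open_around[of r "c * r"]) simp_all
  ultimately show ?thesis by blast
qed

end
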